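(* Let $\mathbb U$ be an absolute universe of combinatorial games (with set of results $\mathcal S$ satisfying $|\mathcal S|\ge 2$), and let $G,H\in\mathbb U$. Then $G\succcurlyeq_{\mathbb U} H$ if and only if both of the following conditions hold. Proviso: (i) $o_L(G+X)\ge o_L(H+X)$ for all Left-atomic $X\in\mathbb U$; and (ii) $o_R(G+X)\ge o_R(H+X)$ for all Right-atomic $X\in\mathbb U$. Maintenance: (iii) for every Right option $G^R$ of $G$, there is a Right option $H^R$ of $H$ such that $G^R\succcurlyeq_{\mathbb U} H^R$, or there is a Left option $G^{RL}$ of $G^R$ such that $G^{RL}\succcurlyeq_{\mathbb U} H$; and (iv) for every Left option $H^L$ of $H$, there is a Left option $G^L$ of $G$ such that $G^L\succcurlyeq_{\mathbb U} H^L$, or there is a Right option $H^{LR}$ of $H^L$ such that $G\succcurlyeq_{\mathbb U} H^{LR}$.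
   Context: **Game forms.** Let $\mathcal A$ be a totally ordered additive abelian group. An atom $\emptyset^a$ ($a\in\mathcal A$) is an empty set of options adorned with $a$. Let $\Omega_0=\{\{\emptyset^\ell\mid\emptyset^r\}:\ell,r\in\mathcal A\}$, and for $n>0$ let $\Omega_n$ be the set of all forms $G=\{G^{\mathcal L}\mid G^{\mathcal R}\}$ in which each of $G^{\mathcal L}$ (set of Left options) and $G^{\mathcal R}$ (set of Right options) is either an atom or a non-empty finite set of elements of $\Omega_{n-1}$. Put $\Omega=\bigcup_n\Omega_n$ (the free space $(\Omega,\mathcal A)$). A form is Left-atomic (Right-atomic) if $G^{\mathcal L}$ ($G^{\mathcal R}$) is an atom. A typical Left (Right) option of $G$ is denoted $G^L$ ($G^R$). **Disjunctive sum.** $G+H$ is defined recursively: if $G^{\mathcal L}=\emptyset^{\ell_1}$ and $H^{\mathcal L}=\emptyset^{\ell_2}$, then the Left side of $G+H$ is $\emptyset^{\ell_1+\ell_2}$; otherwise its Left options are all $G^L+H$ and all $G+H^L$. The Right side is defined analogously. **Conjugate.** The conjugate of $G$ is obtained recursively by swapping the Left and Right sides, conjugating all options, and negating adorns (an atom $\emptyset^{a}$ on one side becomes $\emptyset^{-a}$ on the other side). **Universe.** A universe is a subset $\mathbb U\subseteq\Omega$ such that $\{\emptyset^a\mid\emptyset^a\}\in\mathbb U$ for all $a\in\mathcal A$, and $\mathbb U$ is closed under taking options, disjunctive sums and conjugates. **Evaluation and outcomes.** There are a totally ordered set $\mathcal S$ and order preserving maps $\nu_L,\nu_R:\mathcal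 A\to\mathcal S$, meaning $a<b\Rightarrow\nu_i(a)<\nu_i(b)$; if $|\mathcal A|>1$ (scoring-play) then $\nu_L=\nu_R=:\nu$. By convention $\mathcal S=\nu_L(\mathcal A)\cup\nu_R(\mathcal A)$. Outcomes: $o_L(G)=\nu_L(\ell)$ if $G^{\mathcal L}=\emptyset^\ell$, otherwise $o_L(G)=\max_{G^L} o_R(G^L)$; $o_R(G)=\nu_R(r)$ if $G^{\mathcal R}=\emptyset^r$, otherwise $o_R(G)=\min_{G^R}o_L(G^R)$. **Absolute.** $\mathbb U$ is parental if $\{\mathcal G\mid\mathcal H\}\in\mathbb U$ for all finite non-empty $\mathcal G,\mathcal H\subset\mathbb U$. $\mathbb U$ is (outcome) saturated if for all $G\in\mathbb U$ and all $x,y\in\mathcal S$ there is $H\in\mathbb U$ with $o_L(G+H)\ge x$ and $o_R(G+H)\le y$. $\mathbb U$ is absolute if it is parental and saturated. **Order.** $G\succcurlyeq_{\mathbb U}H$ means $o_L(G+X)\ge o_L(H+X)$ and $o_R(G+X)\ge o_R(H+X)$ for all $X\in\mathbb U$. *)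

theory Defs
  imports "HOL-Library.FSet"
begin

datatype 'a form = Form (left_side: "'a side") (right_side: "'a side")
  and 'a side = Atom 'a | Options "'a form fset"

text \<open>
  An atom carries its adorn; \<open>Options {||}\<close> is not a legal side, and \<open>Omega\<close>
  below excludes it hereditarily.
\<close>

fun opts :: "'a side \<Rightarrow> 'a form fset" where
  "opts (Atom a) = {||}"
| "opts (Options gs) = gs"

definition left_opts :: "'a form \<Rightarrow> 'a form set" where
  "left_opts G = fset (opts (left_side G))"

definition right_opts :: "'a form \<Rightarrow> 'a form set" where
  "right_opts G = fset (opts (right_side G))"

definition left_atomic :: "'a form \<Rightarrow> bool" where
  "left_atomic G \<longleftrightarrow> (\<exists>a. left_side G = Atom a)"

definition right_atomic :: "'a form \<Rightarrow> bool" where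
  "right_atomic G \<longleftrightarrow> (\<exists>a. right_side G = Atom a)"

definition sides_over :: "'a form set \<Rightarrow> 'a side set" where
  "sides_over F = range Atom \<union> {Options gs |gs. gs \<noteq> {||} \<and> fset gs \<subseteq> F}"

primrec Omega_level :: "nat \<Rightarrow> 'a form set" where
  "Omega_level 0 = {Form (Atom l) (Atom r) |l r. True}"
| "Omega_level (Suc n) =
     {Form L R |L R. L \<in> sides_over (Omega_level n) \<and> R \<in> sides_over (Omega_level n)}"

definition Omega :: "'a form set" where
  "Omega = (\<Union>n. Omega_level n)"

lemma size_opts_left:
  "g |\<in>| opts (left_side G) \<Longrightarrow> size g < size G"
proof (cases G)
  case (Form L R)
  assume "g |\<in>| opts (left_side G)"
  then obtain gs where L: "L = Options gs" and g: "g |\<in>| gs"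
    using Form by (cases L) auto
  have "size g \<le> (\<Sum>x\<in>fset gs. Suc (size x))"
    using member_le_sum[of g "fset gs" "\<lambda>x. Suc (size x)"] g by simp
  then show ?thesis
    using Form L by (simp add: size_fset_overloaded_simps)
qed

lemma size_opts_right:
  "g |\<in>| opts (right_side G) \<Longrightarrow> size g < size G"
proof (cases G)
  case (Form L R)
  assume "g |\<in>| opts (right_side G)"
  then obtain gs where R: "R = Options gs" and g: "g |\<in>| gs"
    using Form by (cases R) auto
  have "size g \<le> (\<Sum>x\<in>fset gs. Suc (size x))"
    using member_le_sum[of g "fset gs" "\<lambda>x. Suc (size x)"] g by simp
  then show ?thesis
    using Form R by (simp add: size_fset_overloaded_simps)
qed

function game_sum :: "'a::plus form \<Rightarrow> 'a form \<Rightarrow> 'a form" where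
  "game_sum G H = Form
     (case (left_side G, left_side H) of
        (Atom a, Atom b) \<Rightarrow> Atom (a + b)
      | _ \<Rightarrow> Options ((\<lambda>g. game_sum g H) |`| opts (left_side G) |\<union>|
                     (\<lambda>h. game_sum G h) |`| opts (left_side H)))
     (case (right_side G, right_side H) of
        (Atom a, Atom b) \<Rightarrow> Atom (a + b)
      | _ \<Rightarrow> Options ((\<lambda>g. game_sum g H) |`| opts (right_side G) |\<union>|
                     (\<lambda>h. game_sum G h) |`| opts (right_side H)))"
  by pat_completeness auto
termination
  by (relation "measure (\<lambda>(G, H). size G + size H)")
    (auto dest: size_opts_left size_opts_right)

declare game_sum.simps [simp del]

function conjugate :: "'a::uminus form \<Rightarrow> 'a form" where
  "conjugate G = Form
     (case right_side G of Atom a \<Rightarrow> Atom (- a)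
      | Options gs \<Rightarrow> Options (conjugate |`| gs))
     (case left_side G of Atom a \<Rightarrow> Atom (- a)
      | Options gs \<Rightarrow> Options (conjugate |`| gs))"
  by pat_completeness auto
termination
  by (relation "measure size") (auto intro: size_opts_left size_opts_right)

declare conjugate.simps [simp del]

text \<open>
  The evaluation maps are parameters of the outcome functions: \<open>nL\<close> evaluates Left
  atoms and \<open>nR\<close> evaluates Right atoms.
\<close>

function left_outcome :: "('a \<Rightarrow> 's::linorder) \<Rightarrow> ('a \<Rightarrow> 's) \<Rightarrow> 'a form \<Rightarrow> 's"
  and right_outcome :: "('a \<Rightarrow> 's::linorder) \<Rightarrow> ('a \<Rightarrow> 's) \<Rightarrow> 'a form \<Rightarrow> 's"
where
  "left_outcome nL nR G =
     (case left_side G of Atom l \<Rightarrow> nL l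
      | Options gs \<Rightarrow> Max ((\<lambda>g. right_outcome nL nR g) ` fset gs))"
| "right_outcome nL nR G =
     (case right_side G of Atom r \<Rightarrow> nR r
      | Options gs \<Rightarrow> Min ((\<lambda>g. left_outcome nL nR g) ` fset gs))"
  by pat_completeness auto
termination
  by (relation "measure (case_sum (\<lambda>(nL, nR, G). size G) (\<lambda>(nL, nR, G). size G))")
    (auto intro: size_opts_left size_opts_right)

declare left_outcome.simps [simp del] right_outcome.simps [simp del]

definition evaluation :: "('a::linordered_ab_group_add \<Rightarrow> 's::linorder) \<Rightarrow> ('a \<Rightarrow> 's) \<Rightarrow> bool" where
  "evaluation nL nR \<longleftrightarrow>
     strict_mono nL \<and> strict_mono nR \<and> ((\<exists>a b :: 'a. a \<noteq> b) \<longrightarrow> nL = nR)"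

definition results :: "('a \<Rightarrow> 's) \<Rightarrow> ('a \<Rightarrow> 's) \<Rightarrow> 's set" where
  "results nL nR = range nL \<union> range nR"

definition universe :: "'a::linordered_ab_group_add form set \<Rightarrow> bool" where
  "universe U \<longleftrightarrow>
     U \<subseteq> Omega \<and>
     (\<forall>a. Form (Atom a) (Atom a) \<in> U) \<and>
     (\<forall>G\<in>U. left_opts G \<subseteq> U \<and> right_opts G \<subseteq> U) \<and>
     (\<forall>G\<in>U. \<forall>H\<in>U. game_sum G H \<in> U) \<and>
     (\<forall>G\<in>U. conjugate G \<in> U)"

definition parental :: "'a form set \<Rightarrow> bool" where
  "parental U \<longleftrightarrow>
     (\<forall>gs hs. gs \<noteq> {||} \<and> hs \<noteq> {||} \<and> fset gs \<subseteq> U \<and> fset hs \<subseteq> U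
        \<longrightarrow> Form (Options gs) (Options hs) \<in> U)"

definition saturated :: "('a::plus \<Rightarrow> 's::linorder) \<Rightarrow> ('a \<Rightarrow> 's) \<Rightarrow> 'a form set \<Rightarrow> bool" where
  "saturated nL nR U \<longleftrightarrow>
     (\<forall>G\<in>U. \<forall>x\<in>results nL nR. \<forall>y\<in>results nL nR. \<exists>H\<in>U.
        left_outcome nL nR (game_sum G H) \<ge> x \<and> right_outcome nL nR (game_sum G H) \<le> y)"

definition absolute_universe ::
    "('a::linordered_ab_group_add \<Rightarrow> 's::linorder) \<Rightarrow> ('a \<Rightarrow> 's) \<Rightarrow> 'a form set \<Rightarrow> bool" where
  "absolute_universe nL nR U \<longleftrightarrow> universe U \<and> parental U \<and> saturated nL nR U"

definition game_ge ::
    "('a::plus \<Rightarrow> 's::linorder) \<Rightarrow> ('a \<Rightarrow> 's) \<Rightarrow> 'a form set \<Rightarrow> 'a form \<Rightarrow> 'a form \<Rightarrow> bool" where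
  "game_ge nL nR U G H \<longleftrightarrow>
     (\<forall>X\<in>U. left_outcome nL nR (game_sum G X) \<ge> left_outcome nL nR (game_sum H X) \<and>
            right_outcome nL nR (game_sum G X) \<ge> right_outcome nL nR (game_sum H X))"

definition proviso ::
    "('a::plus \<Rightarrow> 's::linorder) \<Rightarrow> ('a \<Rightarrow> 's) \<Rightarrow> 'a form set \<Rightarrow> 'a form \<Rightarrow> 'a form \<Rightarrow> bool" where
  "proviso nL nR U G H \<longleftrightarrow>
     (\<forall>X\<in>U. left_atomic X \<longrightarrow>
        left_outcome nL nR (game_sum G X) \<ge> left_outcome nL nR (game_sum H X)) \<and>
     (\<forall>X\<in>U. right_atomic X \<longrightarrow>
        right_outcome nL nR (game_sum G X) \<ge> right_outcome nL nR (game_sum H X))"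

definition maintenance ::
    "('a::plus \<Rightarrow> 's::linorder) \<Rightarrow> ('a \<Rightarrow> 's) \<Rightarrow> 'a form set \<Rightarrow> 'a form \<Rightarrow> 'a form \<Rightarrow> bool" where
  "maintenance nL nR U G H \<longleftrightarrow>
     (\<forall>GR\<in>right_opts G.
        (\<exists>HR\<in>right_opts H. game_ge nL nR U GR HR) \<or>
        (\<exists>GRL\<in>left_opts GR. game_ge nL nR U GRL H)) \<and>
     (\<forall>HL\<in>left_opts H.
        (\<exists>GL\<in>left_opts G. game_ge nL nR U GL HL) \<or>
        (\<exists>HLR\<in>right_opts HL. game_ge nL nR U G HLR))"

end

theory Submission
  imports Defs
begin

text \<open>
  Sufficiency is an induction on the test game. For necessity, fix a threshold \<open>t\<close> such that any
  two distinguishable games can be distinguished by outcomes lying on either side of \<open>t\<close>: if the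
  group is trivial, \<open>t\<close> is the larger result; otherwise \<open>t\<close> is the value of \<open>0\<close>, and the test game
  is translated by a number. If no Left option of \<open>G\<close> dominates \<open>H\<close> and \<open>G\<close> dominates no Right
  option of \<open>H\<close>, then the witnesses of these failures, taken as the options of a single game \<open>T\<close>,
  make the Left outcome of \<open>G + T\<close> smaller than \<open>t\<close> and the Right outcome of \<open>H + T\<close> at least \<open>t\<close>.
  A failure of maintenance would therefore contradict the order.
\<close>

section \<open>Options and outcomes of sums\<close>

text \<open>Atoms need no separate case: an atom contributes no options, so both images are empty
  when both sides are atoms.\<close>

lemma left_opts_game_sum:
  "left_opts (game_sum G H) = (\<lambda>g. game_sum g H) ` left_opts G \<union> game_sum G ` left_opts H"
  unfolding left_opts_def by (subst game_sum.simps) (auto split: side.split)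

lemma right_opts_game_sum:
  "right_opts (game_sum G H) = (\<lambda>g. game_sum g H) ` right_opts G \<union> game_sum G ` right_opts H"
  unfolding right_opts_def by (subst game_sum.simps) (auto split: side.split)

lemma left_side_game_sum_atom:
  "left_side G = Atom a \<Longrightarrow> left_side H = Atom b \<Longrightarrow> left_side (game_sum G H) = Atom (a + b)"
  by (subst game_sum.simps) simp

lemma right_side_game_sum_atom:
  "right_side G = Atom a \<Longrightarrow> right_side H = Atom b \<Longrightarrow> right_side (game_sum G H) = Atom (a + b)"
  by (subst game_sum.simps) simp

lemma finite_left_opts [simp]: "finite (left_opts G)"
  by (simp add: left_opts_def)

lemma finite_right_opts [simp]: "finite (right_opts G)"
  by (simp add: right_opts_def)

lemma left_opts_size: "g \<in> left_opts G \<Longrightarrow> size g < size G"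
  by (simp add: left_opts_def size_opts_left)

lemma right_opts_size: "g \<in> right_opts G \<Longrightarrow> size g < size G"
  by (simp add: right_opts_def size_opts_right)

lemma Omega_cases:
  assumes "G \<in> Omega"
  obtains L R where "G = Form L R" "L \<noteq> Options {||}" "R \<noteq> Options {||}"
proof -
  from assms obtain n where "G \<in> Omega_level n"
    by (auto simp: Omega_def)
  then show ?thesis
    using that by (cases n) (auto simp: sides_over_def)
qed

text \<open>\<open>Omega\<close> excludes \<open>Options {||}\<close>, so having no Left options is
  the same as being Left-atomic. This lets later arguments use \<open>left_opts\<close> alone and
  keeps every \<open>Max\<close> over a nonempty set.\<close>

lemma Omega_left_cases:
  assumes "G \<in> Omega"
  obtains a where "left_side G = Atom a" | "left_opts G \<noteq> {}"
proof (cases "left_side G")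
  case (Options gs)
  with assms have "gs \<noteq> {||}"
    by (auto elim: Omega_cases)
  with Options have "left_opts G \<noteq> {}"
    by (auto simp: left_opts_def fset_eq_iff)
  then show ?thesis using that by blast
qed (use that in blast)

lemma Omega_right_cases:
  assumes "G \<in> Omega"
  obtains a where "right_side G = Atom a" | "right_opts G \<noteq> {}"
proof (cases "right_side G")
  case (Options gs)
  with assms have "gs \<noteq> {||}"
    by (auto elim: Omega_cases)
  with Options have "right_opts G \<noteq> {}"
    by (auto simp: right_opts_def fset_eq_iff)
  then show ?thesis using that by blast
qed (use that in blast)

lemma left_outcome_atom: "left_side G = Atom a \<Longrightarrow> left_outcome nL nR G = nL a"
  by (simp add: left_outcome.simps)

lemma right_outcome_atom: "right_side G = Atom a \<Longrightarrow> right_outcome nL nR G = nR a"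
  by (simp add: right_outcome.simps)

lemma left_outcome_Max:
  "left_opts G \<noteq> {} \<Longrightarrow> left_outcome nL nR G = Max (right_outcome nL nR ` left_opts G)"
  by (cases "left_side G") (auto simp: left_outcome.simps left_opts_def)

lemma right_outcome_Min:
  "right_opts G \<noteq> {} \<Longrightarrow> right_outcome nL nR G = Min (left_outcome nL nR ` right_opts G)"
  by (cases "right_side G") (auto simp: right_outcome.simps right_opts_def)

lemma left_outcome_less_iff:
  "left_opts G \<noteq> {} \<Longrightarrow>
    left_outcome nL nR G < t \<longleftrightarrow> (\<forall>g\<in>left_opts G. right_outcome nL nR g < t)"
  by (simp add: left_outcome_Max)

lemma right_outcome_less_iff:
  "right_opts G \<noteq> {} \<Longrightarrow>
    right_outcome nL nR G < t \<longleftrightarrow> (\<exists>g\<in>right_opts G. left_outcome nL nR g < t)"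
  by (simp add: right_outcome_Min Min_less_iff)

lemma left_outcome_le_iff:
  "left_opts G \<noteq> {} \<Longrightarrow>
    left_outcome nL nR G \<le> t \<longleftrightarrow> (\<forall>g\<in>left_opts G. right_outcome nL nR g \<le> t)"
  by (simp add: left_outcome_Max)

lemma right_outcome_ge_iff:
  "right_opts G \<noteq> {} \<Longrightarrow>
    t \<le> right_outcome nL nR G \<longleftrightarrow> (\<forall>g\<in>right_opts G. t \<le> left_outcome nL nR g)"
  by (simp add: right_outcome_Min)

lemma right_outcome_le_left_outcome:
  "g \<in> left_opts G \<Longrightarrow> right_outcome nL nR g \<le> left_outcome nL nR G"
  by (subst left_outcome_Max) auto

lemma right_outcome_le_left_outcome_option:
  "g \<in> right_opts G \<Longrightarrow> right_outcome nL nR G \<le> left_outcome nL nR g"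
  by (subst right_outcome_Min) auto

section \<open>Working in a fixed absolute universe\<close>

locale absolute_games =
  fixes nL nR :: "'a::linordered_ab_group_add \<Rightarrow> 's::linorder" and U :: "'a form set"
  assumes evaluation: "evaluation nL nR"
    and two_results: "\<exists>x\<in>results nL nR. \<exists>y\<in>results nL nR. x \<noteq> y"
    and absolute: "absolute_universe nL nR U"
begin

abbreviation oL :: "'a form \<Rightarrow> 's" where "oL \<equiv> left_outcome nL nR"
abbreviation oR :: "'a form \<Rightarrow> 's" where "oR \<equiv> right_outcome nL nR"
abbreviation num :: "'a \<Rightarrow> 'a form" where "num a \<equiv> Form (Atom a) (Atom a)"

lemma
  shows in_Omega: "G \<in> U \<Longrightarrow> G \<in> Omega"
    and num_in: "num a \<in> U"
    and left_opts_in: "G \<in> U \<Longrightarrow> g \<in> left_opts G \<Longrightarrow> g \<in> U"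
    and right_opts_in: "G \<in> U \<Longrightarrow> g \<in> right_opts G \<Longrightarrow> g \<in> U"
    and game_sum_in: "G \<in> U \<Longrightarrow> H \<in> U \<Longrightarrow> game_sum G H \<in> U"
  using absolute unfolding absolute_universe_def universe_def by blast+

lemma saturatedE:
  assumes "G \<in> U" "x \<in> results nL nR" "y \<in> results nL nR"
  obtains H where "H \<in> U" "x \<le> oL (game_sum G H)" "oR (game_sum G H) \<le> y"
  using absolute assms unfolding absolute_universe_def saturated_def by blast

lemma parentalE:
  assumes "finite A" "A \<noteq> {}" "A \<subseteq> U" and "finite B" "B \<noteq> {}" "B \<subseteq> U"
  obtains T where "T \<in> U" "left_opts T = A" "right_opts T = B"
proof -
  from assms obtain gs hs where "fset gs = A" "fset hs = B"
    by (metis Abs_fset_inverse mem_Collect_eq)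
  moreover from this assms have "gs \<noteq> {||}" "hs \<noteq> {||}"
    by auto
  ultimately have "Form (Options gs) (Options hs) \<in> U"
    using absolute assms unfolding absolute_universe_def parental_def by simp
  with that \<open>fset gs = A\<close> \<open>fset hs = B\<close> show ?thesis
    by (force simp: left_opts_def right_opts_def)
qed

text \<open>\<open>Max\<close> and \<open>Min\<close> over finite nonempty sets are attained, so an
  outcome can be followed down to the value of an adorn. That adorn later tells by how much to
  translate a test game.\<close>

lemma outcomes_in_results:
  "G \<in> U \<Longrightarrow> oL G \<in> results nL nR \<and> oR G \<in> results nL nR"
proof (induction "size G" arbitrary: G rule: less_induct)
  case less
  have "oL G \<in> results nL nR"
    using in_Omega[OF less.prems]
  proof (cases rule: Omega_left_cases)
    case 2
    then have "oL G \<in> oR ` left_opts G"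
      by (simp add: left_outcome_Max)
    then obtain g where "g \<in> left_opts G" "oL G = oR g"
      by auto
    then show ?thesis
      using less.hyps[of g] left_opts_size[of g G] left_opts_in[OF less.prems, of g] by simp
  qed (simp add: left_outcome_atom results_def)
  moreover have "oR G \<in> results nL nR"
    using in_Omega[OF less.prems]
  proof (cases rule: Omega_right_cases)
    case 2
    then have "oR G \<in> oL ` right_opts G"
      by (simp add: right_outcome_Min)
    then obtain g where "g \<in> right_opts G" "oR G = oL g"
      by auto
    then show ?thesis
      using less.hyps[of g] right_opts_size[of g G] right_opts_in[OF less.prems, of g] by simp
  qed (simp add: right_outcome_atom results_def)
  ultimately show ?case ..
qed

section \<open>One-sided bounds obtained from saturation\<close>

text \<open>
  Saturation only bounds \<open>oR (G + A)\<close> from above. If Left starts on \<open>G + {A | A, B\<^sub>1, B\<^sub>2, \<dots>}\<close>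
  with a move in \<open>G\<close> to its \<open>i\<close>-th Left option, then Right replies with \<open>B\<^sub>i\<close>.
\<close>

lemma left_outcome_small:
  assumes "G \<in> U" "y \<in> results nL nR"
  shows "\<exists>B\<in>U. oL (game_sum G B) \<le> y"
  using assms(1)
proof (induction "size G" arbitrary: G rule: less_induct)
  case less
  have "\<forall>g\<in>left_opts G. \<exists>B\<in>U. oL (game_sum g B) \<le> y"
    using less.hyps[OF left_opts_size left_opts_in[OF less.prems]] by blast
  then obtain f where f: "\<And>g. g \<in> left_opts G \<Longrightarrow> f g \<in> U \<and> oL (game_sum g (f g)) \<le> y"
    by metis
  obtain A where A: "A \<in> U" "oR (game_sum G A) \<le> y"
    using saturatedE less.prems assms(2) by metis
  \<comment> \<open>As a Left option, \<open>A\<close> disposes of Left's opening move in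
    \<open>T\<close>. As a Right option it only keeps that side nonempty when \<open>G\<close> has
    no Left options.\<close>
  obtain T where T: "T \<in> U" "left_opts T = {A}" "right_opts T = insert A (f ` left_opts G)"
    using parentalE[of "{A}" "insert A (f ` left_opts G)"] A f by auto
  have "oR (game_sum g T) \<le> y" if "g \<in> left_opts G" for g
  proof -
    have "game_sum g (f g) \<in> right_opts (game_sum g T)"
      using that T by (auto simp: right_opts_game_sum)
    then show ?thesis
      using f[OF that] right_outcome_le_left_outcome_option order_trans by blast
  qed
  then have "oL (game_sum G T) \<le> y"
    using T A by (subst left_outcome_le_iff) (auto simp: left_opts_game_sum)
  with T show ?case by blast
qed

text \<open>Dual construction: Right's opening move in \<open>T\<close> can only be to
  \<open>B\<close>, and a move from \<open>G\<close> to \<open>g\<close> is answered by Left's move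
  from \<open>T\<close> to \<open>f g\<close>.\<close>

lemma right_outcome_large:
  assumes "G \<in> U" "x \<in> results nL nR"
  shows "\<exists>A\<in>U. x \<le> oR (game_sum G A)"
  using assms(1)
proof (induction "size G" arbitrary: G rule: less_induct)
  case less
  have "\<forall>g\<in>right_opts G. \<exists>A\<in>U. x \<le> oR (game_sum g A)"
    using less.hyps[OF right_opts_size right_opts_in[OF less.prems]] by blast
  then obtain f where f: "\<And>g. g \<in> right_opts G \<Longrightarrow> f g \<in> U \<and> x \<le> oR (game_sum g (f g))"
    by metis
  obtain B where B: "B \<in> U" "x \<le> oL (game_sum G B)"
    using saturatedE less.prems assms(2) by metis
  obtain T where T: "T \<in> U" "left_opts T = insert B (f ` right_opts G)" "right_opts T = {B}"
    using parentalE[of "insert B (f ` right_opts G)" "{B}"] B f by auto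
  have "x \<le> oL (game_sum g T)" if "g \<in> right_opts G" for g
  proof -
    have "game_sum g (f g) \<in> left_opts (game_sum g T)"
      using that T by (auto simp: left_opts_game_sum)
    then show ?thesis
      using f[OF that] right_outcome_le_left_outcome order_trans by blast
  qed
  then have "x \<le> oR (game_sum G T)"
    using T B by (subst right_outcome_ge_iff) (auto simp: right_opts_game_sum)
  with T show ?case by blast
qed

section \<open>Translation by numbers and the threshold\<close>

text \<open>A number has no options, so play is unchanged and every final adorn is shifted by
  \<open>a\<close>. Results cannot be added, so the shift is expressed by comparison with the values
  of adorns.\<close>

lemma translate_outcomes_less_iff:
  assumes "nL = nR" and "G \<in> U" "X \<in> U"
  shows "(oL (game_sum G (game_sum X (num a))) < nL (s + a) \<longleftrightarrow> oL (game_sum G X) < nL s) \<and>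
    (oR (game_sum G (game_sum X (num a))) < nR (s + a) \<longleftrightarrow> oR (game_sum G X) < nR s)"
  using assms(2,3)
proof (induction "size G + size X" arbitrary: G X rule: less_induct)
  case less
  have num_opts: "left_opts (num a) = {}" "right_opts (num a) = {}"
    by (auto simp: left_opts_def right_opts_def)
  have mono: "nL (b + a) < nL (s + a) \<longleftrightarrow> nL b < nL s" for b
    using evaluation by (simp add: evaluation_def strict_mono_less)
  \<comment> \<open>Play alternates, so a bound on \<open>oL\<close> rests on bounds on
    \<open>oR\<close> against the same map; \<open>nL = nR\<close> permits the exchange.\<close>
  have IH:
    "oR (game_sum G' (game_sum X' (num a))) < nL (s + a) \<longleftrightarrow> oR (game_sum G' X') < nL s"
    "oL (game_sum G' (game_sum X' (num a))) < nR (s + a) \<longleftrightarrow> oL (game_sum G' X') < nR s"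
    if "size G' + size X' < size G + size X" "G' \<in> U" "X' \<in> U" for G' X'
    using less.hyps[OF that] assms(1) by auto
  have L: "oL (game_sum G (game_sum X (num a))) < nL (s + a) \<longleftrightarrow> oL (game_sum G X) < nL s"
  proof (cases "left_opts G = {} \<and> left_opts X = {}")
    case True
    then obtain b c where "left_side G = Atom b" "left_side X = Atom c"
      using less.prems in_Omega by (metis Omega_left_cases)
    then show ?thesis
      using mono[of "b + c"]
      by (simp add: left_side_game_sum_atom left_outcome_atom add.assoc)
  next
    case False
    then show ?thesis
      using less.prems
      by (auto simp: left_outcome_less_iff left_opts_game_sum num_opts ball_Un IH
          left_opts_size left_opts_in)
  qed
  have R: "oR (game_sum G (game_sum X (num a))) < nR (s + a) \<longleftrightarrow> oR (game_sum G X) < nR s"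
  proof (cases "right_opts G = {} \<and> right_opts X = {}")
    case True
    then obtain b c where "right_side G = Atom b" "right_side X = Atom c"
      using less.prems in_Omega by (metis Omega_right_cases)
    then show ?thesis
      using mono[of "b + c"] assms(1)
      by (simp add: right_side_game_sum_atom right_outcome_atom add.assoc)
  next
    case False
    then show ?thesis
      using less.prems
      by (auto simp: right_outcome_less_iff right_opts_game_sum num_opts bex_Un IH
          right_opts_size right_opts_in)
  qed
  show ?case using L R ..
qed

text \<open>A single \<open>t\<close> serves all pairs of games, so witnesses from different pairs
  can become options of one test game. The smaller result \<open>y\<close> turns the weak bounds
  given by saturation into strict ones below \<open>t\<close>.\<close>

definition threshold :: "'s \<Rightarrow> bool" where
  "threshold t \<longleftrightarrow> t \<in> results nL nR \<and> (\<exists>y\<in>results nL nR. y < t) \<and>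
    (\<forall>G\<in>U. \<forall>H\<in>U. \<forall>X\<in>U.
      (oL (game_sum G X) < oL (game_sum H X) \<longrightarrow>
        (\<exists>Y\<in>U. oL (game_sum G Y) < t \<and> t \<le> oL (game_sum H Y))) \<and>
      (oR (game_sum G X) < oR (game_sum H X) \<longrightarrow>
        (\<exists>Y\<in>U. oR (game_sum G Y) < t \<and> t \<le> oR (game_sum H Y))))"

lemma threshold_exists: "\<exists>t. threshold t"
proof (cases "\<exists>a b :: 'a. a \<noteq> b")
  case True
  then have eq: "nL = nR"
    using evaluation by (simp add: evaluation_def)
  obtain a :: 'a where "a \<noteq> 0"
    using True by metis
  then have "a < 0 \<or> - a < 0"
    by auto
  then obtain b :: 'a where "b < 0"
    by blast
  then have "nL b < nL 0"
    using evaluation by (simp add: evaluation_def strict_mono_less)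
  moreover have "\<exists>Y\<in>U. oL (game_sum G Y) < nL 0 \<and> nL 0 \<le> oL (game_sum H Y)"
    if "G \<in> U" "H \<in> U" "X \<in> U" "oL (game_sum G X) < oL (game_sum H X)" for G H X
  proof -
    \<comment> \<open>\<open>s\<close> is read off the larger outcome, so that translation by
      \<open>- s\<close> turns the bound \<open>nL s\<close> into \<open>nL 0\<close>.\<close>
    obtain s where s: "oL (game_sum H X) = nL s"
      using outcomes_in_results[OF game_sum_in[OF \<open>H \<in> U\<close> \<open>X \<in> U\<close>]] eq by (auto simp: results_def)
    have "oL (game_sum G (game_sum X (num (- s)))) < nL 0"
      using translate_outcomes_less_iff[of G X "- s" s] that s eq by simp
    moreover have "\<not> oL (game_sum H (game_sum X (num (- s)))) < nL 0"
      using translate_outcomes_less_iff[of H X "- s" s] that s eq by simp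
    ultimately show ?thesis
      using that game_sum_in num_in not_less by blast
  qed
  moreover have "\<exists>Y\<in>U. oR (game_sum G Y) < nL 0 \<and> nL 0 \<le> oR (game_sum H Y)"
    if "G \<in> U" "H \<in> U" "X \<in> U" "oR (game_sum G X) < oR (game_sum H X)" for G H X
  proof -
    obtain s where s: "oR (game_sum H X) = nR s"
      using outcomes_in_results[OF game_sum_in[OF \<open>H \<in> U\<close> \<open>X \<in> U\<close>]] eq by (auto simp: results_def)
    have "oR (game_sum G (game_sum X (num (- s)))) < nL 0"
      using translate_outcomes_less_iff[of G X "- s" s] that s eq by simp
    moreover have "\<not> oR (game_sum H (game_sum X (num (- s)))) < nL 0"
      using translate_outcomes_less_iff[of H X "- s" s] that s eq by simp
    ultimately show ?thesis
      using that game_sum_in num_in not_less by blast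
  qed
  ultimately have "threshold (nL 0)"
    unfolding threshold_def results_def by blast
  then show ?thesis ..
next
  case False
  then have zero: "a = 0" for a :: 'a
    by blast
  have res: "results nL nR = {nL 0, nR 0}"
    unfolding results_def using zero by (auto simp: image_iff) metis+
  define t where "t = max (nL 0) (nR 0)"
  have "t \<in> results nL nR" "\<exists>y\<in>results nL nR. y < t"
    using two_results by (auto simp: res t_def max_def)
  \<comment> \<open>With just two results, \<open>x < y\<close> forces \<open>y = t\<close>, so the
    distinguishing game \<open>X\<close> itself serves as \<open>Y\<close>.\<close>
  moreover have "x < t \<and> t \<le> y" if "x < y" "x \<in> results nL nR" "y \<in> results nL nR" for x y
    using that by (auto simp: res t_def)
  ultimately have "threshold t"
    unfolding threshold_def using outcomes_in_results[OF game_sum_in] by meson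
  then show ?thesis ..
qed

section \<open>Separating games at the threshold\<close>

text \<open>A difference may appear only when Right starts, through some \<open>X\<close>. Then
  \<open>T\<close> has \<open>X\<close> as its only Left option: Left profits from moving to it in
  \<open>H + T\<close> but not in \<open>G + T\<close>, and Left's moves in \<open>G\<close> are
  refuted by replies from \<open>left_outcome_small\<close>.\<close>

lemma left_outcome_separation:
  assumes t: "threshold t" and "G \<in> U" "H \<in> U" "\<not> game_ge nL nR U G H"
  shows "\<exists>X\<in>U. oL (game_sum G X) < t \<and> t \<le> oL (game_sum H X)"
proof -
  consider X where "X \<in> U" "oL (game_sum G X) < t" "t \<le> oL (game_sum H X)"
    | X where "X \<in> U" "oR (game_sum G X) < t" "t \<le> oR (game_sum H X)"
    using assms unfolding threshold_def game_ge_def not_le[symmetric] by metis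
  then show ?thesis
  proof cases
    case 2
    obtain y where y: "y \<in> results nL nR" "y < t"
      using t by (auto simp: threshold_def)
    have "\<forall>g\<in>left_opts G. \<exists>B\<in>U. oL (game_sum g B) < t"
      using left_outcome_small[OF _ y(1)] left_opts_in assms(2) y(2) order.strict_trans1 by metis
    then obtain f where f: "\<And>g. g \<in> left_opts G \<Longrightarrow> f g \<in> U \<and> oL (game_sum g (f g)) < t"
      by metis
    obtain T where T: "T \<in> U" "left_opts T = {X}" "right_opts T = insert X (f ` left_opts G)"
      using parentalE[of "{X}" "insert X (f ` left_opts G)"] 2 f by auto
    have "oR (game_sum g T) < t" if "g \<in> left_opts G" for g
      using f[OF that] that T by (subst right_outcome_less_iff) (auto simp: right_opts_game_sum)
    then have "oL (game_sum G T) < t"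
      using T 2 by (subst left_outcome_less_iff) (auto simp: left_opts_game_sum)
    moreover have "t \<le> oL (game_sum H T)"
      using right_outcome_le_left_outcome[of "game_sum H X" "game_sum H T" nL nR] 2 T
      by (auto simp: left_opts_game_sum)
    ultimately show ?thesis
      using T by blast
  qed blast
qed

text \<open>Starting from a separation of Left outcomes by \<open>X\<close>, \<open>T\<close> lets
  Right move only to \<open>X\<close>. Right's moves in \<open>H\<close> are answered using
  \<open>right_outcome_large\<close>.\<close>

lemma right_outcome_separation:
  assumes t: "threshold t" and "G \<in> U" "H \<in> U" "\<not> game_ge nL nR U G H"
  shows "\<exists>X\<in>U. oR (game_sum G X) < t \<and> t \<le> oR (game_sum H X)"
proof -
  obtain X where X: "X \<in> U" "oL (game_sum G X) < t" "t \<le> oL (game_sum H X)"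
    using left_outcome_separation[OF assms] by blast
  have "\<forall>h\<in>right_opts H. \<exists>A\<in>U. t \<le> oR (game_sum h A)"
    using right_outcome_large right_opts_in assms(3) t unfolding threshold_def by metis
  then obtain f where f: "\<And>h. h \<in> right_opts H \<Longrightarrow> f h \<in> U \<and> t \<le> oR (game_sum h (f h))"
    by metis
  obtain T where T: "T \<in> U" "left_opts T = insert X (f ` right_opts H)" "right_opts T = {X}"
    using parentalE[of "insert X (f ` right_opts H)" "{X}"] X f by auto
  have "t \<le> oL (game_sum h T)" if "h \<in> right_opts H" for h
    using f[OF that] right_outcome_le_left_outcome[of "game_sum h (f h)" "game_sum h T" nL nR] that T
    by (auto simp: left_opts_game_sum)
  then have "t \<le> oR (game_sum H T)"
    using T X by (subst right_outcome_ge_iff) (auto simp: right_opts_game_sum)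
  moreover have "oR (game_sum G T) < t"
    using T X by (subst right_outcome_less_iff) (auto simp: right_opts_game_sum)
  ultimately show ?thesis
    using T by blast
qed

section \<open>Necessity of maintenance\<close>

text \<open>A move to an option passes the turn, which is why a Left outcome is compared with a
  Right outcome.\<close>

lemma downlink:
  assumes "G \<in> U" "H \<in> U"
    and left: "\<And>g. g \<in> left_opts G \<Longrightarrow> \<not> game_ge nL nR U g H"
    and right: "\<And>h. h \<in> right_opts H \<Longrightarrow> \<not> game_ge nL nR U G h"
  shows "\<exists>T\<in>U. oL (game_sum G T) < oR (game_sum H T)"
proof -
  obtain t where t: "threshold t"
    using threshold_exists ..
  then obtain y where y: "y \<in> results nL nR" "y < t" and t_res: "t \<in> results nL nR"
    by (auto simp: threshold_def)
  have "\<forall>h\<in>right_opts H. \<exists>X\<in>U. oR (game_sum G X) < t \<and> t \<le> oR (game_sum h X)"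
    using right_outcome_separation[OF t] right assms right_opts_in by metis
  then obtain f where f: "\<And>h. h \<in> right_opts H \<Longrightarrow>
      f h \<in> U \<and> oR (game_sum G (f h)) < t \<and> t \<le> oR (game_sum h (f h))"
    by metis
  have "\<forall>g\<in>left_opts G. \<exists>Y\<in>U. oL (game_sum g Y) < t \<and> t \<le> oL (game_sum H Y)"
    using left_outcome_separation[OF t] left assms left_opts_in by metis
  then obtain k where k: "\<And>g. g \<in> left_opts G \<Longrightarrow>
      k g \<in> U \<and> oL (game_sum g (k g)) < t \<and> t \<le> oL (game_sum H (k g))"
    by metis
  \<comment> \<open>\<open>X\<close> and \<open>Y\<close> keep the two sides of \<open>T\<close>
    nonempty; saturation chooses them so that moving to them does not help the opening
    player.\<close>
  obtain X where X: "X \<in> U" "oR (game_sum G X) < t"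
    using saturatedE[OF assms(1) t_res y(1)] y(2) order.strict_trans1 by metis
  obtain Y where Y: "Y \<in> U" "t \<le> oL (game_sum H Y)"
    using saturatedE[OF assms(2) t_res y(1)] by metis
  \<comment> \<open>Each witness has two uses. In \<open>G + T\<close>, Left's moves to
    \<open>f h\<close> are already bad and a move to \<open>g\<close> is answered by
    \<open>k g\<close>. In \<open>H + T\<close>, Right's moves to \<open>k g\<close> are already bad
    and a move to \<open>h\<close> is answered by \<open>f h\<close>.\<close>
  obtain T where T: "T \<in> U" "left_opts T = insert X (f ` right_opts H)"
      "right_opts T = insert Y (k ` left_opts G)"
    using parentalE[of "insert X (f ` right_opts H)" "insert Y (k ` left_opts G)"] X Y f k
    by (auto simp: image_subset_iff)
  have "oR (game_sum g T) < t" if "g \<in> left_opts G" for g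
    using k[OF that] that T by (subst right_outcome_less_iff) (auto simp: right_opts_game_sum)
  then have "oL (game_sum G T) < t"
    using T X f by (subst left_outcome_less_iff) (auto simp: left_opts_game_sum)
  moreover have "t \<le> oL (game_sum h T)" if "h \<in> right_opts H" for h
    using f[OF that] right_outcome_le_left_outcome[of "game_sum h (f h)" "game_sum h T" nL nR] that T
    by (auto simp: left_opts_game_sum)
  then have "t \<le> oR (game_sum H T)"
    using T Y k by (subst right_outcome_ge_iff) (auto simp: right_opts_game_sum)
  ultimately show ?thesis
    using T by (meson order.strict_trans2)
qed

text \<open>If a Right option \<open>g\<close> of \<open>G\<close> violates maintenance,
  \<open>downlink\<close> for \<open>g\<close> and \<open>H\<close> gives
  \<open>oR (G + T) \<le> oL (g + T) < oR (H + T)\<close>, against the order. A Left option of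
  \<open>H\<close> is treated dually.\<close>

lemma game_ge_maintenance:
  assumes "G \<in> U" "H \<in> U" and ge: "game_ge nL nR U G H"
  shows "maintenance nL nR U G H"
proof -
  have "(\<exists>h\<in>right_opts H. game_ge nL nR U g h) \<or> (\<exists>g'\<in>left_opts g. game_ge nL nR U g' H)"
    if g: "g \<in> right_opts G" for g
  proof (rule ccontr)
    assume "\<not> ?thesis"
    then obtain T where T: "T \<in> U" "oL (game_sum g T) < oR (game_sum H T)"
      using downlink[of g H] g assms right_opts_in by blast
    have "oR (game_sum G T) \<le> oL (game_sum g T)"
      using g by (intro right_outcome_le_left_outcome_option) (simp add: right_opts_game_sum)
    moreover have "oR (game_sum H T) \<le> oR (game_sum G T)"
      using ge T by (simp add: game_ge_def)
    ultimately show False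
      using T by simp
  qed
  moreover have "(\<exists>g\<in>left_opts G. game_ge nL nR U g h) \<or> (\<exists>h'\<in>right_opts h. game_ge nL nR U G h')"
    if h: "h \<in> left_opts H" for h
  proof (rule ccontr)
    assume "\<not> ?thesis"
    then obtain T where T: "T \<in> U" "oL (game_sum G T) < oR (game_sum h T)"
      using downlink[of G h] h assms left_opts_in by blast
    have "oR (game_sum h T) \<le> oL (game_sum H T)"
      using h by (intro right_outcome_le_left_outcome) (simp add: left_opts_game_sum)
    moreover have "oL (game_sum H T) \<le> oL (game_sum G T)"
      using ge T by (simp add: game_ge_def)
    ultimately show False
      using T by simp
  qed
  ultimately show ?thesis
    by (simp add: maintenance_def)
qed

section \<open>Sufficiency of proviso and maintenance\<close>

text \<open>For the Left outcome, Left moves in \<open>H + X\<close> are matched in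
  \<open>G + X\<close>: a move in \<open>X\<close> is copied, and a move to \<open>h\<close> is met
  by a dominating \<open>g\<close>, or bounded through Right's reply \<open>h'\<close>, which
  \<open>G\<close> dominates. The proviso covers Left-atomic \<open>X\<close>.\<close>

lemma game_geI:
  assumes "proviso nL nR U G H" "maintenance nL nR U G H"
  shows "game_ge nL nR U G H"
proof -
  have "oL (game_sum H X) \<le> oL (game_sum G X) \<and> oR (game_sum H X) \<le> oR (game_sum G X)"
    if "X \<in> U" for X
    using that
  proof (induction "size X" arbitrary: X rule: less_induct)
    case less
    have "oL (game_sum H X) \<le> oL (game_sum G X)"
      using in_Omega[OF less.prems]
    proof (cases rule: Omega_left_cases)
      case (1 a)
      then show ?thesis
        using assms(1) less.prems by (auto simp: proviso_def left_atomic_def)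
    next
      case 2
      have "oR (game_sum H x) \<le> oL (game_sum G X)" if "x \<in> left_opts X" for x
      proof -
        have "oR (game_sum H x) \<le> oR (game_sum G x)"
          using less that left_opts_in left_opts_size by blast
        also have "\<dots> \<le> oL (game_sum G X)"
          using that by (intro right_outcome_le_left_outcome) (simp add: left_opts_game_sum)
        finally show ?thesis .
      qed
      moreover have "oR (game_sum h X) \<le> oL (game_sum G X)" if "h \<in> left_opts H" for h
      proof -
        consider g where "g \<in> left_opts G" "game_ge nL nR U g h"
          | h' where "h' \<in> right_opts h" "game_ge nL nR U G h'"
          using assms(2) \<open>h \<in> left_opts H\<close> by (auto simp: maintenance_def)
        then show ?thesis
        proof cases
          case 1
          then have "oR (game_sum h X) \<le> oR (game_sum g X)"
            using less.prems by (simp add: game_ge_def)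
          also have "\<dots> \<le> oL (game_sum G X)"
            using 1 by (intro right_outcome_le_left_outcome) (simp add: left_opts_game_sum)
          finally show ?thesis .
        next
          case 2
          then have "oR (game_sum h X) \<le> oL (game_sum h' X)"
            by (intro right_outcome_le_left_outcome_option) (simp add: right_opts_game_sum)
          also have "\<dots> \<le> oL (game_sum G X)"
            using 2 less.prems by (simp add: game_ge_def)
          finally show ?thesis .
        qed
      qed
      ultimately show ?thesis
        using 2 by (subst left_outcome_le_iff) (auto simp: left_opts_game_sum)
    qed
    moreover have "oR (game_sum H X) \<le> oR (game_sum G X)"
      using in_Omega[OF less.prems]
    proof (cases rule: Omega_right_cases)
      case (1 a)
      then show ?thesis
        using assms(1) less.prems by (auto simp: proviso_def right_atomic_def)
    next
      \<comment> \<open>Here Right's opening moves in \<open>G + X\<close> are the ones to be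
        matched by moves in \<open>H + X\<close>.\<close>
      case 2
      have "oR (game_sum H X) \<le> oL (game_sum G x)" if "x \<in> right_opts X" for x
      proof -
        have "oR (game_sum H X) \<le> oL (game_sum H x)"
          using that by (intro right_outcome_le_left_outcome_option) (simp add: right_opts_game_sum)
        also have "\<dots> \<le> oL (game_sum G x)"
          using less that right_opts_in right_opts_size by blast
        finally show ?thesis .
      qed
      moreover have "oR (game_sum H X) \<le> oL (game_sum g X)" if "g \<in> right_opts G" for g
      proof -
        consider h where "h \<in> right_opts H" "game_ge nL nR U g h"
          | g' where "g' \<in> left_opts g" "game_ge nL nR U g' H"
          using assms(2) \<open>g \<in> right_opts G\<close> by (auto simp: maintenance_def)
        then show ?thesis
        proof cases
          case 1
          then have "oR (game_sum H X) \<le> oL (game_sum h X)"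
            by (intro right_outcome_le_left_outcome_option) (simp add: right_opts_game_sum)
          also have "\<dots> \<le> oL (game_sum g X)"
            using 1 less.prems by (simp add: game_ge_def)
          finally show ?thesis .
        next
          case 2
          then have "oR (game_sum H X) \<le> oR (game_sum g' X)"
            using less.prems by (simp add: game_ge_def)
          also have "\<dots> \<le> oL (game_sum g X)"
            using 2 by (intro right_outcome_le_left_outcome) (simp add: left_opts_game_sum)
          finally show ?thesis .
        qed
      qed
      ultimately show ?thesis
        using 2 by (subst right_outcome_ge_iff) (auto simp: right_opts_game_sum)
    qed
    ultimately show ?case ..
  qed
  then show ?thesis
    by (simp add: game_ge_def)
qed

end

theorem theorem4:
  fixes nL nR :: "'a::linordered_ab_group_add \<Rightarrow> 's::linorder"
    and U :: "'a form set" and G H :: "'a form"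
  assumes "evaluation nL nR"
    and "\<exists>x\<in>results nL nR. \<exists>y\<in>results nL nR. x \<noteq> y"
    and "absolute_universe nL nR U"
    and "G \<in> U" and "H \<in> U"
  shows "game_ge nL nR U G H \<longleftrightarrow> proviso nL nR U G H \<and> maintenance nL nR U G H"
proof -
  interpret absolute_games nL nR U
    using assms(1-3) by unfold_locales
  have "proviso nL nR U G H" if "game_ge nL nR U G H"
    using that by (simp add: proviso_def game_ge_def)
  then show ?thesis
    using game_geI game_ge_maintenance assms(4,5) by blast
qed

end
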